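(* Let $T\ge 0$ and let $\overline{\overline{R}}(T,0)=\overline{R}(T,0)\cap\mathbb{B}_{know}$, where $\overline{R}(T,0)$ is the set of all values $\phi(T)$ of solutions $\phi$ on $[0,T]$ of the differential inclusion $\dot x\in\overline{\mathcal{V}}^{\mathcal{G}}_x$, $x(0)=0$ (equivalently, the reachable set at time $T$ of the control system $\dot x=f(0)+g(\|x\|)u$, $x(0)=0$, $u\in\mathcal{U}$). Then $$\overline{\overline{R}}(T,0)\subseteq R^{\mathcal{G}}(T,0).$$
   Context: Let $n\ge 1$. For vectors, $\|\cdot\|$ is the Euclidean norm; for matrices, $\|M\|=\max_{\|v\|=1}\|Mv\|$. $\mathbb{B}^n(c;r)$ is the closed ball in $\mathbb{R}^n$ with center $c$ and radius $r\ge 0$. Setting: $\mathcal{U}=\mathbb{B}^n(0;1)$; $L_f,L_G\ge 0$ are real constants with $L_f+L_G>0$; $f:\mathbb{R}^n\to\mathbb{R}^n$ and $G:\mathbb{R}^n\to\mathbb{R}^{n\times n}$ satisfy $\|f(x)-f(y)\|\le L_f\|x-y\|$ and $\|G(x)-G(y)\|\le L_G\|x-y\|$ for all $x,y\in\mathbb{R}^n$, and $G(0)$ is invertible. $\mathcal{D}_{con}$ is the set of all pairs $(\hat f,\hat G)$ of functions $\hat f:\mathbb{R}^n\to\mathbb{R}^n$, $\hat G:\mathbb{R}^n\to\mathbb{R}^{n\times n}$ such that $\hat f(0)=f(0)$, $\hat G(0)=G(0)$, $\hat f$ is globally Lipschitz with constant $L_f$, and $\hat G$ is globally Lipschitz with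 constant $L_G$. For $(\hat f,\hat G)\in\mathcal{D}_{con}$, $R^{\hat f,\hat G}(T,0)$ is the set of all $\phi(T)$, where $\phi$ is the trajectory on $[0,T]$ of $\dot x(t)=\hat f(x(t))+\hat G(x(t))u(t)$, $x(0)=0$, for some control signal $u:[0,T]\to\mathcal{U}$. The guaranteed reachability set is $R^{\mathcal{G}}(T,0)=\bigcap_{(\hat f,\hat G)\in\mathcal{D}_{con}}R^{\hat f,\hat G}(T,0)$. Define $\mathbb{B}_{know}=\mathbb{B}^n\left(0;1/((L_f+L_G)\|G(0)^{-1}\|)\right)$. For $x\in\mathbb{B}_{know}$ let $\overline{\mathcal{V}}^{\mathcal{G}}_x=\mathbb{B}^n\left(f(0);\|G(0)^{-1}\|^{-1}-L_f\|x\|-L_G\|x\|\right)$, and for $x\notin\mathbb{B}_{know}$ let $\overline{\mathcal{V}}^{\mathcal{G}}_x=\{f(0)\}$. The function $g:[0,+\infty)\to\mathbb{R}$ is $g(s)=\|G(0)^{-1}\|^{-1}-(L_G+L_f)s$ if $s\le\|G(0)^{-1}\|^{-1}/(L_G+L_f)$, and $g(s)=0$ otherwise. Convention: control signals are measurable, and trajectories of control systems and differential inclusions are absolutely continuous functions satisfying the equation or inclusion for almost every time. *)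

theory Defs
  imports "HOL-Analysis.Analysis"
begin

text \<open>The operator norm of a matrix for the Euclidean vector norm. The instance \<open>norm\<close> on
  \<open>real ^ 'n ^ 'n\<close> is the Frobenius norm, so neither it nor \<open>lipschitz_on\<close> can be used for
  matrix-valued functions.\<close>

definition opnorm :: "real ^ 'n ^ 'n \<Rightarrow> real"
  where "opnorm M = onorm (\<lambda>v. M *v v)"

definition matrix_lipschitz :: "real \<Rightarrow> (real ^ 'n \<Rightarrow> real ^ 'n ^ 'n) \<Rightarrow> bool"
  where "matrix_lipschitz L G \<longleftrightarrow> (\<forall>x y. opnorm (G x - G y) \<le> L * norm (x - y))"

text \<open>The \<open>\<epsilon>\<close>-\<open>\<delta>\<close> definition of absolute continuity on \<open>{a..b}\<close>; \<open>D division_of \<Union>D\<close> says that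
  \<open>D\<close> is a finite family of nonempty compact intervals \<open>K = {Inf K..Sup K}\<close> without common
  interior points.\<close>

definition absolutely_continuous_on_Icc ::
    "real \<Rightarrow> real \<Rightarrow> (real \<Rightarrow> 'a::real_normed_vector) \<Rightarrow> bool"
  where "absolutely_continuous_on_Icc a b \<phi> \<longleftrightarrow>
    (\<forall>\<epsilon>>0. \<exists>\<delta>>0. \<forall>D. D division_of \<Union>D \<longrightarrow> \<Union>D \<subseteq> {a..b} \<longrightarrow> (\<Sum>K\<in>D. measure lborel K) < \<delta> \<longrightarrow>
      (\<Sum>K\<in>D. norm (\<phi> (Sup K) - \<phi> (Inf K))) < \<epsilon>)"

definition control_signal :: "real \<Rightarrow> (real \<Rightarrow> real ^ 'n) \<Rightarrow> bool"
  where "control_signal T u \<longleftrightarrow>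
    u \<in> borel_measurable (lebesgue_on {0..T}) \<and> (\<forall>t\<in>{0..T}. u t \<in> cball 0 1)"

definition control_trajectory ::
    "(real ^ 'n \<Rightarrow> real ^ 'n \<Rightarrow> real ^ 'n) \<Rightarrow> real \<Rightarrow> real ^ 'n \<Rightarrow> (real \<Rightarrow> real ^ 'n)
      \<Rightarrow> (real \<Rightarrow> real ^ 'n) \<Rightarrow> bool"
  where "control_trajectory F T x0 u \<phi> \<longleftrightarrow>
    absolutely_continuous_on_Icc 0 T \<phi> \<and> \<phi> 0 = x0 \<and>
    (AE t in lebesgue_on {0..T}.
      (\<phi> has_vector_derivative F (\<phi> t) (u t)) (at t within {0..T}))"

definition control_reach ::
    "(real ^ 'n \<Rightarrow> real ^ 'n \<Rightarrow> real ^ 'n) \<Rightarrow> real \<Rightarrow> real ^ 'n \<Rightarrow> (real ^ 'n) set"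
  where "control_reach F T x0 = {\<phi> T | \<phi> u. control_signal T u \<and> control_trajectory F T x0 u \<phi>}"

definition inclusion_trajectory ::
    "(real ^ 'n \<Rightarrow> (real ^ 'n) set) \<Rightarrow> real \<Rightarrow> real ^ 'n \<Rightarrow> (real \<Rightarrow> real ^ 'n) \<Rightarrow> bool"
  where "inclusion_trajectory V T x0 \<phi> \<longleftrightarrow>
    absolutely_continuous_on_Icc 0 T \<phi> \<and> \<phi> 0 = x0 \<and>
    (AE t in lebesgue_on {0..T}.
      \<exists>v\<in>V (\<phi> t). (\<phi> has_vector_derivative v) (at t within {0..T}))"

definition inclusion_reach ::
    "(real ^ 'n \<Rightarrow> (real ^ 'n) set) \<Rightarrow> real \<Rightarrow> real ^ 'n \<Rightarrow> (real ^ 'n) set"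
  where "inclusion_reach V T x0 = {\<phi> T | \<phi>. inclusion_trajectory V T x0 \<phi>}"

definition D_con :: "real \<Rightarrow> real \<Rightarrow> (real ^ 'n \<Rightarrow> real ^ 'n) \<Rightarrow> (real ^ 'n \<Rightarrow> real ^ 'n ^ 'n)
    \<Rightarrow> ((real ^ 'n \<Rightarrow> real ^ 'n) \<times> (real ^ 'n \<Rightarrow> real ^ 'n ^ 'n)) set"
  where "D_con Lf LG f G = {(fh, Gh).
    fh 0 = f 0 \<and> Gh 0 = G 0 \<and> Lf-lipschitz_on UNIV fh \<and> matrix_lipschitz LG Gh}"

definition guaranteed_reach :: "real \<Rightarrow> real \<Rightarrow> (real ^ 'n \<Rightarrow> real ^ 'n)
    \<Rightarrow> (real ^ 'n \<Rightarrow> real ^ 'n ^ 'n) \<Rightarrow> real \<Rightarrow> (real ^ 'n) set"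
  where "guaranteed_reach Lf LG f G T =
    (\<Inter>(fh, Gh)\<in>D_con Lf LG f G. control_reach (\<lambda>x v. fh x + Gh x *v v) T 0)"

definition B_know :: "real \<Rightarrow> real \<Rightarrow> (real ^ 'n \<Rightarrow> real ^ 'n ^ 'n) \<Rightarrow> (real ^ 'n) set"
  where "B_know Lf LG G = cball 0 (1 / ((Lf + LG) * opnorm (matrix_inv (G 0))))"

definition V_bar :: "real \<Rightarrow> real \<Rightarrow> (real ^ 'n \<Rightarrow> real ^ 'n)
    \<Rightarrow> (real ^ 'n \<Rightarrow> real ^ 'n ^ 'n) \<Rightarrow> real ^ 'n \<Rightarrow> (real ^ 'n) set"
  where "V_bar Lf LG f G x =
    (if x \<in> B_know Lf LG G
     then cball (f 0) (inverse (opnorm (matrix_inv (G 0))) - Lf * norm x - LG * norm x)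
     else {f 0})"

text \<open>Only the values at arguments \<open>s \<ge> 0\<close> are meaningful.\<close>

definition g_fun :: "real \<Rightarrow> real \<Rightarrow> (real ^ 'n \<Rightarrow> real ^ 'n ^ 'n) \<Rightarrow> real \<Rightarrow> real"
  where "g_fun Lf LG G s =
    (if s \<le> inverse (opnorm (matrix_inv (G 0))) / (LG + Lf)
     then inverse (opnorm (matrix_inv (G 0))) - (LG + Lf) * s
     else 0)"

end

theory Submission
  imports Defs
begin

text \<open>Where \<open>\<phi>\<close> satisfies the inclusion inside \<open>B_know\<close> and \<open>\<rho> = LG * norm (\<phi> t)\<close>, the matrix
  \<open>Gh (\<phi> t)\<close> is a perturbation of \<open>G 0\<close> of size at most \<open>\<rho>\<close>, so it scales norms by a factor of at
  least \<open>inverse (opnorm (matrix_inv (G 0))) - \<rho>\<close>, which also bounds the norm of the right-hand side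
  \<open>\<phi>' t - fh (\<phi> t)\<close>. Hence the same curve \<open>\<phi>\<close> is a trajectory of every admissible system, with
  the control obtained by solving the linear system by Cramer's rule, which makes it measurable. Outside
  \<open>B_know\<close> the curve is straight, so convexity of the ball shows that a curve ending in the ball
  never leaves it.\<close>

section \<open>Absolutely continuous curves and constant derivatives\<close>

lemma absolutely_continuous_on_Icc_subset:
  assumes "absolutely_continuous_on_Icc a b \<phi>" "{c..d} \<subseteq> {a..b}"
  shows "absolutely_continuous_on_Icc c d \<phi>"
  using assms unfolding absolutely_continuous_on_Icc_def by (meson order_trans)

lemma absolutely_continuous_on_Icc_imp_continuous_on:
  assumes "absolutely_continuous_on_Icc a b \<phi>"
  shows "continuous_on {a..b} \<phi>"
  unfolding continuous_on_iff
proof (intro ballI allI impI)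
  fix x \<epsilon> :: real
  assume x: "x \<in> {a..b}" and "\<epsilon> > 0"
  then obtain \<delta> where \<delta>: "\<delta> > 0" and small:
      "\<And>D. D division_of \<Union>D \<Longrightarrow> \<Union>D \<subseteq> {a..b} \<Longrightarrow> (\<Sum>K\<in>D. measure lborel K) < \<delta> \<Longrightarrow>
        (\<Sum>K\<in>D. norm (\<phi> (Sup K) - \<phi> (Inf K))) < \<epsilon>"
    using assms unfolding absolutely_continuous_on_Icc_def by metis
  have ord: "dist (\<phi> t) (\<phi> s) < \<epsilon>" if "s \<in> {a..b}" "t \<in> {a..b}" "s \<le> t" "t - s < \<delta>" for s t
  proof -
    have "{cbox s t} division_of \<Union>{cbox s t}"
      using division_of_self[of s t] that by (simp add: box_real)
    then show ?thesis
      using small[of "{cbox s t}"] that by (auto simp: box_real dist_norm)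
  qed
  show "\<exists>d>0. \<forall>x'\<in>{a..b}. dist x' x < d \<longrightarrow> dist (\<phi> x') (\<phi> x) < \<epsilon>"
  proof (intro exI[of _ \<delta>] conjI ballI impI)
    fix y assume y: "y \<in> {a..b}" "dist y x < \<delta>"
    show "dist (\<phi> y) (\<phi> x) < \<epsilon>"
    proof (cases "x \<le> y")
      case True
      then show ?thesis using ord[of x y] x y by (auto simp: dist_real_def)
    next
      case False
      then show ?thesis using ord[of y x] x y by (auto simp: dist_real_def dist_commute)
    qed
  qed (use \<delta> in simp)
qed

text \<open>Outer regularity gives an open \<open>U\<close> with \<open>U - N\<close> small, and
  adding back the null set \<open>N\<close> leaves the measure unchanged.\<close>

lemma negligible_subset_open_small:
  fixes N :: "'a::euclidean_space set" and e :: real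
  assumes "negligible N" "e > 0"
  obtains U where "open U" "N \<subseteq> U" "U \<in> lmeasurable" "measure lebesgue U < e"
proof -
  have N: "N \<in> null_sets lebesgue"
    using assms(1) by (simp add: negligible_iff_null_sets)
  obtain U where U: "open U" "N \<subseteq> U" "U - N \<in> lmeasurable" "emeasure lebesgue (U - N) < ennreal e"
    using sets_lebesgue_outer_open[of N e] N assms(2) by blast
  have em: "emeasure lebesgue U = emeasure lebesgue (U - N)"
    using U N by (metis borel_open emeasure_Diff_null_set sets_completionI_sets sets_lborel)
  have lm: "U \<in> lmeasurable"
    using U em N by (intro fmeasurableI) (auto simp: fmeasurable_def intro: order.strict_trans)
  have "measure lebesgue U < e"
    using U em assms(2) lm by (simp add: emeasure_eq_measure2 ennreal_less_iff)
  then show ?thesis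
    using that U lm by blast
qed

text \<open>The Lebesgue form of the fundamental theorem for a constant derivative. In a fine tagged
  division, the intervals tagged inside the exceptional null set have small total length, so
  absolute continuity controls them; the others are controlled by differentiability.\<close>

lemma absolutely_continuous_constant_derivative:
  fixes \<phi> :: "real \<Rightarrow> 'a::real_normed_vector"
  assumes ac: "absolutely_continuous_on_Icc a b \<phi>" and "a \<le> b" and N: "negligible N"
    and deriv: "\<And>t. t \<in> {a..b} - N \<Longrightarrow> (\<phi> has_vector_derivative c) (at t within {a..b})"
  shows "\<phi> b - \<phi> a = (b - a) *\<^sub>R c"
proof -
  define h where "h K = norm (\<phi> (Sup K) - \<phi> (Inf K) - (Sup K - Inf K) *\<^sub>R c)" for K
  have "norm (\<phi> b - \<phi> a - (b - a) *\<^sub>R c) \<le> 0 + \<epsilon>" if "\<epsilon> > 0" for \<epsilon>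
  proof -
    \<comment> \<open>The share \<open>e * (b - a)\<close> pays for the intervals tagged outside
      \<open>N\<close>; those tagged in \<open>N\<close> cost \<open>e\<close> for the increments of
      \<open>\<phi>\<close> and another \<open>e\<close> for their lengths times
      \<open>norm c\<close>.\<close>
    define e where "e = \<epsilon> / (2 + (b - a))"
    have e: "e > 0" using that \<open>a \<le> b\<close> by (simp add: e_def)
    obtain \<delta> where \<delta>: "\<delta> > 0" and small:
        "\<And>D. D division_of \<Union>D \<Longrightarrow> \<Union>D \<subseteq> {a..b} \<Longrightarrow> (\<Sum>K\<in>D. measure lborel K) < \<delta> \<Longrightarrow>
          (\<Sum>K\<in>D. norm (\<phi> (Sup K) - \<phi> (Inf K))) < e"
      using ac e unfolding absolutely_continuous_on_Icc_def by metis
    \<comment> \<open>A total length below \<open>\<eta>\<close> is short enough for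
      \<open>small\<close> and contributes at most \<open>e\<close> after multiplication by
      \<open>norm c\<close>; the \<open>+ 1\<close> covers \<open>c = 0\<close>.\<close>
    define \<eta> where "\<eta> = min \<delta> (e / (norm c + 1))"
    have \<eta>: "\<eta> > 0" using \<delta> e by (auto simp: \<eta>_def add_nonneg_pos)
    have \<eta>c: "\<eta> * norm c \<le> e"
    proof -
      have "\<eta> * norm c \<le> e / (norm c + 1) * norm c"
        by (intro mult_right_mono) (auto simp: \<eta>_def)
      also have "\<dots> \<le> e"
      proof -
        have "norm c + 1 > 0" by (simp add: add_nonneg_pos)
        then show ?thesis using e by (simp add: pos_divide_le_eq mult.commute)
      qed
      finally show ?thesis .
    qed
    obtain U where U: "open U" "N \<subseteq> U" "U \<in> lmeasurable" "measure lebesgue U < \<eta>"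
      using negligible_subset_open_small[OF N \<eta>] .
    \<comment> \<open>One radius per tag: at a point of \<open>N\<close> the ball must fit into
      \<open>U\<close>, at any other point of the interval it must make the derivative estimate
      valid.\<close>
    have "\<exists>d>0. (t \<in> N \<longrightarrow> ball t d \<subseteq> U) \<and>
        (t \<in> {a..b} - N \<longrightarrow> (\<forall>y\<in>{a..b}. norm (y - t) < d \<longrightarrow>
          norm (\<phi> y - \<phi> t - (y - t) *\<^sub>R c) \<le> e * norm (y - t)))" for t
    proof (cases "t \<in> N")
      case True
      then show ?thesis using U by (metis Diff_iff open_contains_ball subsetD)
    next
      case False
      show ?thesis
      proof (cases "t \<in> {a..b}")
        case True
        with False show ?thesis
          using deriv[of t] e unfolding has_vector_derivative_def has_derivative_within_alt by blast
      next
        case out: False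
        show ?thesis using False out by (intro exI[of _ 1]) auto
      qed
    qed
    then obtain d where d: "\<And>t. d t > 0" "\<And>t. t \<in> N \<Longrightarrow> ball t (d t) \<subseteq> U"
      "\<And>t y. t \<in> {a..b} - N \<Longrightarrow> y \<in> {a..b} \<Longrightarrow> norm (y - t) < d t \<Longrightarrow>
          norm (\<phi> y - \<phi> t - (y - t) *\<^sub>R c) \<le> e * norm (y - t)"
      by metis
    have "gauge (\<lambda>t. ball t (d t))"
      using d(1) by (rule gauge_ball_dependent[rule_format])
    then obtain p where p: "p tagged_division_of {a..b}" and fine: "(\<lambda>t. ball t (d t)) fine p"
      by (rule fine_division_exists_real)
    have fin: "finite p" using p by blast
    have interval: "\<exists>u v. K = {u..v} \<and> u \<le> v \<and> a \<le> u \<and> v \<le> b \<and> x \<in> {u..v} \<and> K \<subseteq> ball x (d x)"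
      if xK: "(x, K) \<in> p" for x K
    proof -
      obtain u v where "K = cbox u v" using tagged_division_ofD(4)[OF p xK] by blast
      moreover have "x \<in> K" "K \<subseteq> {a..b}" using tagged_division_ofD(2,3)[OF p xK] by auto
      moreover have "K \<subseteq> ball x (d x)" using fine xK by (auto simp: fine_def)
      ultimately show ?thesis by (force simp: box_real)
    qed
    define q where "q = {z \<in> p. fst z \<in> N}"
    have qp: "q \<subseteq> p" by (auto simp: q_def)
    have tp: "q tagged_partial_division_of {a..b}"
      using p qp tagged_partial_division_subset tagged_division_of_def by blast
    have div: "snd ` q division_of \<Union>(snd ` q)"
      using partial_division_of_tagged_division[OF tp] .
    have inU: "\<Union>(snd ` q) \<subseteq> U"
      using interval d(2) by (force simp: q_def)
    have inab: "\<Union>(snd ` q) \<subseteq> {a..b}"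
      using interval by (force simp: q_def)
    have qK: "\<exists>u v. K = {u..v} \<and> u \<le> v" if "K \<in> snd ` q" for K
      using that interval qp by force
    have len: "(\<Sum>K\<in>snd ` q. measure lborel K) < \<eta>"
    proof -
      have "(\<Sum>K\<in>snd ` q. measure lborel K) = measure lebesgue (\<Union>(snd ` q))"
      proof -
        have "(\<Sum>K\<in>snd ` q. measure lborel K) = (\<Sum>K\<in>snd ` q. measure lebesgue K)"
          using qK by (intro sum.cong refl) (metis atLeastAtMost_borel measure_completion sets_lborel)
        then show ?thesis using content_division[OF div] by simp
      qed
      also have "\<dots> \<le> measure lebesgue U"
        using inU U by (intro measure_mono_fmeasurable)
          (auto simp: lmeasurable_division[OF div] fmeasurableD)
      finally show ?thesis using U by simp
    qed
    have sum_q: "(\<Sum>(x,K)\<in>q. h K) \<le> e + e"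
    proof -
      \<comment> \<open>The rule that replaces tagged pairs by bare intervals needs a summand
        vanishing on every box with empty interior: \<open>h\<close> does so on single points, and
        the guard adds the empty set, where \<open>Sup\<close> and \<open>Inf\<close> have no useful
        value.\<close>
      have "(\<Sum>(x,K)\<in>q. h K) = (\<Sum>(x,K)\<in>q. if K = {} then 0 else h K)"
        using interval qp by (intro sum.cong) fastforce+
      also have "\<dots> = (\<Sum>K\<in>snd ` q. if K = {} then 0 else h K)"
        by (rule sum.over_tagged_division_lemma[OF tagged_partial_division_of_Union_self[OF tp]])
           (auto simp: h_def box_real)
      also have "\<dots> \<le> (\<Sum>K\<in>snd ` q. norm (\<phi> (Sup K) - \<phi> (Inf K)) + measure lborel K * norm c)"
      proof (rule sum_mono)
        fix K assume "K \<in> snd ` q"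
        then obtain u v where K: "K = {u..v}" "u \<le> v" using qK by blast
        have "h K \<le> norm (\<phi> v - \<phi> u) + norm ((v - u) *\<^sub>R c)"
          using K norm_triangle_ineq4[of "\<phi> v - \<phi> u" "(v - u) *\<^sub>R c"] by (simp add: h_def)
        then show "(if K = {} then 0 else h K)
            \<le> norm (\<phi> (Sup K) - \<phi> (Inf K)) + measure lborel K * norm c"
          using K by simp
      qed
      also have "\<dots> = (\<Sum>K\<in>snd ` q. norm (\<phi> (Sup K) - \<phi> (Inf K)))
          + (\<Sum>K\<in>snd ` q. measure lborel K) * norm c"
        by (simp add: sum.distrib sum_distrib_right)
      also have "\<dots> \<le> e + \<eta> * norm c"
        using small[OF div inab] len
        by (intro add_mono mult_right_mono) (auto simp: \<eta>_def)
      finally show ?thesis using \<eta>c by simp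
    qed
    have "(\<Sum>(x,K)\<in>p - q. h K) \<le> (\<Sum>(x,K)\<in>p - q. e * (Sup K - Inf K))"
    proof (rule sum_mono, clarify)
      fix x K assume xK: "(x, K) \<in> p" "(x, K) \<notin> q"
      then obtain u v where K: "K = {u..v}" "u \<le> v" "a \<le> u" "v \<le> b" "x \<in> {u..v}" "K \<subseteq> ball x (d x)"
        using interval by blast
      have x: "x \<in> {a..b} - N" using xK K by (auto simp: q_def)
      have "u \<in> K" "v \<in> K" using K by auto
      then have "u \<in> ball x (d x)" "v \<in> ball x (d x)" using K(6) by blast+
      then have "norm (\<phi> u - \<phi> x - (u - x) *\<^sub>R c) \<le> e * norm (u - x)"
        "norm (\<phi> v - \<phi> x - (v - x) *\<^sub>R c) \<le> e * norm (v - x)"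
        using d(3)[OF x, of u] d(3)[OF x, of v] K by (auto simp: dist_norm norm_minus_commute)
      \<comment> \<open>The tag \<open>x\<close> lies between \<open>u\<close> and \<open>v\<close>,
        so the two errors measured from \<open>x\<close> add up to
        \<open>e * (v - u)\<close>.\<close>
      moreover have "norm (\<phi> v - \<phi> u - (v - u) *\<^sub>R c)
          \<le> norm (\<phi> v - \<phi> x - (v - x) *\<^sub>R c) + norm (\<phi> u - \<phi> x - (u - x) *\<^sub>R c)"
      proof -
        have "\<phi> v - \<phi> u - (v - u) *\<^sub>R c
            = (\<phi> v - \<phi> x - (v - x) *\<^sub>R c) - (\<phi> u - \<phi> x - (u - x) *\<^sub>R c)"
          by (simp add: algebra_simps)
        then show ?thesis by (metis norm_triangle_ineq4)
      qed
      ultimately have "norm (\<phi> v - \<phi> u - (v - u) *\<^sub>R c) \<le> e * norm (v - x) + e * norm (u - x)"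
        by linarith
      also have "\<dots> = e * (v - u)" using K by (simp add: algebra_simps)
      finally show "h K \<le> e * (Sup K - Inf K)" using K by (simp add: h_def)
    qed
    also have "\<dots> \<le> (\<Sum>(x,K)\<in>p. e * (Sup K - Inf K))"
    proof (rule sum_mono2[OF fin])
      fix z assume "z \<in> p - (p - q)"
      then obtain x K where z: "z = (x, K)" "(x, K) \<in> p" by (cases z) auto
      then obtain u v where "K = {u..v}" "u \<le> v" using interval by blast
      then show "0 \<le> (case z of (x, K) \<Rightarrow> e * (Sup K - Inf K))" using z e by simp
    qed auto
    also have "\<dots> = e * (\<Sum>(x,K)\<in>p. Sup K - Inf K)"
      by (simp add: sum_distrib_left case_prod_unfold)
    also have "\<dots> = e * (b - a)"
      using additive_tagged_division_1[OF \<open>a \<le> b\<close> p, of "\<lambda>x. x"] by simp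
    finally have sum_pq: "(\<Sum>(x,K)\<in>p - q. h K) \<le> e * (b - a)" .
    \<comment> \<open>The increments of \<open>\<lambda>x. \<phi> x - x *\<^sub>R c\<close>
      telescope over the division.\<close>
    have "\<phi> b - \<phi> a - (b - a) *\<^sub>R c
        = (\<Sum>(x,K)\<in>p. \<phi> (Sup K) - \<phi> (Inf K) - (Sup K - Inf K) *\<^sub>R c)"
      using additive_tagged_division_1[OF \<open>a \<le> b\<close> p, of "\<lambda>x. \<phi> x - x *\<^sub>R c"]
      by (simp add: algebra_simps)
    also have "norm \<dots> \<le> (\<Sum>(x,K)\<in>p. h K)"
      by (rule order_trans[OF norm_sum]) (simp add: h_def case_prod_unfold)
    also have "\<dots> = (\<Sum>(x,K)\<in>p - q. h K) + (\<Sum>(x,K)\<in>q. h K)"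
      using sum.subset_diff[OF qp fin] by blast
    also have "\<dots> \<le> e * (b - a) + (e + e)" using sum_pq sum_q by linarith
    also have "\<dots> = e * (2 + (b - a))" by (simp add: algebra_simps)
    also have "\<dots> = \<epsilon>" using \<open>a \<le> b\<close> by (simp add: e_def)
    finally show ?thesis by simp
  qed
  then have "norm (\<phi> b - \<phi> a - (b - a) *\<^sub>R c) \<le> 0"
    by (rule field_le_epsilon)
  then show ?thesis by simp
qed

text \<open>If \<open>\<phi> t\<close> were outside \<open>C\<close>, the last time \<open>s\<close>
  in \<open>C\<close> before \<open>t\<close> and the first time \<open>s'\<close> in
  \<open>C\<close> after it would bound an excursion with constant velocity \<open>c\<close>. Then
  \<open>\<phi> t\<close> would lie on the segment from \<open>\<phi> s\<close> to
  \<open>\<phi> s'\<close>, hence in \<open>C\<close>.\<close>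

lemma stays_in_convex_if_straight_outside:
  fixes \<phi> :: "real \<Rightarrow> 'a::real_normed_vector"
  assumes ac: "absolutely_continuous_on_Icc 0 T \<phi>" and "convex C" "closed C"
    and start: "\<phi> 0 \<in> C" and last: "\<phi> T \<in> C"
    and N: "negligible N"
    and deriv: "\<And>r. r \<in> {0..T} - N \<Longrightarrow> \<phi> r \<notin> C \<Longrightarrow> (\<phi> has_vector_derivative c) (at r within {0..T})"
    and t: "t \<in> {0..T}"
  shows "\<phi> t \<in> C"
proof (rule ccontr)
  assume out: "\<phi> t \<notin> C"
  have cont: "continuous_on {0..T} \<phi>"
    using absolutely_continuous_on_Icc_imp_continuous_on[OF ac] .
  have "closed ({0..T} \<inter> \<phi> -` C)"
    using cont \<open>closed C\<close> by (intro continuous_closed_preimage) auto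
  then have compact: "compact ({0..T} \<inter> \<phi> -` C \<inter> {p..q})" for p q
    by (metis closed_Int_compact compact_Icc)
  have "0 \<in> {0..T} \<inter> \<phi> -` C \<inter> {0..t}" "T \<in> {0..T} \<inter> \<phi> -` C \<inter> {t..T}"
    using start last t by auto
  then have nonempty: "{0..T} \<inter> \<phi> -` C \<inter> {0..t} \<noteq> {}" "{0..T} \<inter> \<phi> -` C \<inter> {t..T} \<noteq> {}"
    by blast+
  obtain s where s: "s \<in> {0..T} \<inter> \<phi> -` C \<inter> {0..t}"
      and s_max: "\<And>r. r \<in> {0..T} \<inter> \<phi> -` C \<inter> {0..t} \<Longrightarrow> r \<le> s"
    using compact_attains_sup[OF compact nonempty(1)] by blast
  obtain s' where s': "s' \<in> {0..T} \<inter> \<phi> -` C \<inter> {t..T}"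
      and s'_min: "\<And>r. r \<in> {0..T} \<inter> \<phi> -` C \<inter> {t..T} \<Longrightarrow> s' \<le> r"
    using compact_attains_inf[OF compact nonempty(2)] by blast
  have between: "\<phi> r \<notin> C" if "s < r" "r < s'" for r
  proof
    assume "\<phi> r \<in> C"
    then show False
      using that s s' s_max[of r] s'_min[of r] by (cases "r \<le> t") auto
  qed
  have straight: "\<phi> r - \<phi> s = (r - s) *\<^sub>R c" if "s \<le> r" "r \<le> s'" for r
  \<comment> \<open>At \<open>s\<close> and \<open>s'\<close> the curve is in \<open>C\<close>,
    where \<open>deriv\<close> says nothing, so both times join the exceptional set.\<close>
  proof (rule absolutely_continuous_constant_derivative[where N = "N \<union> {s, s'}"])
    show "absolutely_continuous_on_Icc s r \<phi>"
      using absolutely_continuous_on_Icc_subset[OF ac] that s s' by auto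
    show "negligible (N \<union> {s, s'})" using N by simp
    show "(\<phi> has_vector_derivative c) (at x within {s..r})" if "x \<in> {s..r} - (N \<union> {s, s'})" for x
      using that \<open>r \<le> s'\<close> s s' between[of x]
      by (intro has_vector_derivative_within_subset[OF deriv[of x]]) auto
  qed (use that in auto)
  have st: "s < t" "t < s'"
    using s s' out by (auto simp: less_le)
  \<comment> \<open>The elapsed fraction of the excursion, which at constant velocity is also the
    position along the chord.\<close>
  define \<theta> where "\<theta> = (t - s) / (s' - s)"
  have \<theta>: "0 \<le> \<theta>" "\<theta> \<le> 1" "\<theta> * (s' - s) = t - s"
    using st by (auto simp: \<theta>_def)
  have "\<phi> t = \<phi> s + (\<theta> * (s' - s)) *\<^sub>R c"
    using straight[of t] st unfolding \<theta>(3) by (simp add: diff_eq_eq add.commute)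
  also have "\<dots> = \<phi> s + \<theta> *\<^sub>R (\<phi> s' - \<phi> s)"
    using straight[of s'] st by simp
  also have "\<dots> = (1 - \<theta>) *\<^sub>R \<phi> s + \<theta> *\<^sub>R \<phi> s'"
    by (simp add: algebra_simps)
  also have "\<dots> \<in> C"
    using \<open>convex C\<close> \<theta> s s' by (intro convexD) auto
  finally show False using out by simp
qed

section \<open>Measurable derivatives and controls\<close>

text \<open>Forward difference quotients are continuous in \<open>t\<close>, so their limit is
  measurable. Controls extracted from a curve inherit measurability from \<open>v\<close>.\<close>

lemma borel_measurable_derivative_version:
  fixes \<phi> :: "real \<Rightarrow> 'a::euclidean_space"
  assumes cont: "continuous_on {a..b} \<phi>"
  obtains v where "v \<in> borel_measurable (lebesgue_on {a..b})"
    and "\<And>t d. t \<in> {a..<b} \<Longrightarrow> (\<phi> has_vector_derivative d) (at t within {a..b}) \<Longrightarrow> v t = d"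
proof -
  \<comment> \<open>Clamping at \<open>b\<close> keeps the argument inside the interval where
    \<open>\<phi>\<close> is continuous. At \<open>t = b\<close> every quotient is then zero, hence
    the half-open interval in the conclusion.\<close>
  define Q where "Q i t = real (Suc i) *\<^sub>R (\<phi> (min b (t + 1 / real (Suc i))) - \<phi> t)" for i t
  have step: "t \<le> t + 1 / (1 + real i)" for t i by simp
  have "continuous_on {a..b} (Q i)" for i
    unfolding Q_def
    by (intro continuous_intros cont continuous_on_compose2[OF cont, of _ "\<lambda>t. min b (t + _ t)"])
       (auto intro: order_trans[OF _ step])
  then have meas: "Q i \<in> borel_measurable (lebesgue_on {a..b})" for i
    by (intro continuous_imp_measurable_on_sets_lebesgue) auto
  show ?thesis
  proof (rule that[of "\<lambda>t. lim (\<lambda>i. Q i t)"])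
    show "(\<lambda>t. lim (\<lambda>i. Q i t)) \<in> borel_measurable (lebesgue_on {a..b})"
      using meas by (rule borel_measurable_lim_metric)
    fix t d
    assume t: "t \<in> {a..<b}" and d: "(\<phi> has_vector_derivative d) (at t within {a..b})"
    have "(\<lambda>i. Q i t) \<longlonglongrightarrow> d"
    proof (rule tendstoI)
      fix e :: real assume "e > 0"
      then obtain \<delta> where \<delta>: "\<delta> > 0" "\<And>y. y \<in> {a..b} \<Longrightarrow> norm (y - t) < \<delta> \<Longrightarrow>
          norm (\<phi> y - \<phi> t - (y - t) *\<^sub>R d) \<le> e / 2 * norm (y - t)"
        using d unfolding has_vector_derivative_def has_derivative_within_alt
        by (meson half_gt_zero)
      have "(\<lambda>i. 1 / real (Suc i)) \<longlonglongrightarrow> 0"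
        using LIMSEQ_inverse_real_of_nat by (simp add: inverse_eq_divide)
      \<comment> \<open>The bound \<open>b - t\<close> makes the clamp inactive, the bound
        \<open>\<delta>\<close> makes the derivative estimate apply.\<close>
      then have "\<forall>\<^sub>F i in sequentially. 1 / real (Suc i) < min \<delta> (b - t)"
        using \<delta> t by (intro order_tendstoD) auto
      then show "\<forall>\<^sub>F i in sequentially. dist (Q i t) d < e"
      proof eventually_elim
        case (elim i)
        define h where "h = 1 / real (Suc i)"
        have h: "h > 0" "h < \<delta>" "t + h \<le> b" using elim by (auto simp: h_def)
        have "Q i t - d = (1 / h) *\<^sub>R (\<phi> (t + h) - \<phi> t - h *\<^sub>R d)"
          using h by (simp add: Q_def h_def scaleR_diff_right min_def del: of_nat_Suc)
        then have "dist (Q i t) d = norm (\<phi> (t + h) - \<phi> t - h *\<^sub>R d) / h"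
          using h by (simp add: dist_norm)
        also have "\<dots> \<le> (e / 2 * h) / h"
          using \<delta>(2)[of "t + h"] h t by (intro divide_right_mono) auto
        also have "\<dots> < e" using h \<open>e > 0\<close> by simp
        finally show ?case .
      qed
    qed
    then show "lim (\<lambda>i. Q i t) = d" by (rule limI)
  qed
qed

lemma AE_lebesgue_on_Icc_iff:
  fixes a b :: real
  shows "(AE t in lebesgue_on {a..b}. P t) \<longleftrightarrow> (\<exists>N. negligible N \<and> (\<forall>t\<in>{a..b} - N. P t))"
proof -
  have "(AE t in lebesgue_on {a..b}. P t) \<longleftrightarrow> (AE t in lebesgue. t \<in> {a..b} \<longrightarrow> P t)"
    by (rule AE_restrict_space_iff) simp
  also have "\<dots> \<longleftrightarrow> (\<exists>N. negligible N \<and> (\<forall>t\<in>{a..b} - N. P t))"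
    unfolding eventually_ae_filter negligible_iff_null_sets Bex_def
    by (intro arg_cong[of _ _ Ex] ext) auto
  finally show ?thesis .
qed

text \<open>A control signal must stay in the unit ball at every time, whereas constructed controls
  do so only almost everywhere. Resetting \<open>w\<close> to 0 where the bound fails affects the
  differential equation only on a null set.\<close>

lemma control_reachI:
  assumes "absolutely_continuous_on_Icc 0 T \<phi>" "\<phi> 0 = x0"
    and w: "w \<in> borel_measurable (lebesgue_on {0..T})"
    and ae: "AE t in lebesgue_on {0..T}. norm (w t) \<le> 1 \<and>
      (\<phi> has_vector_derivative F (\<phi> t) (w t)) (at t within {0..T})"
  shows "\<phi> T \<in> control_reach F T x0"
proof -
  define u where "u t = (if norm (w t) \<le> 1 then w t else 0)" for t
  have "u \<in> borel_measurable (lebesgue_on {0..T})"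
    unfolding u_def using w by measurable
  then have "control_signal T u"
    by (auto simp: control_signal_def u_def)
  moreover have "control_trajectory F T x0 u \<phi>"
    using assms by (auto simp: control_trajectory_def u_def elim: eventually_mono)
  ultimately show ?thesis
    unfolding control_reach_def by blast
qed

section \<open>Operator norm, inverse matrices and Cramer's rule\<close>

lemma norm_matrix_vector_le_opnorm: "norm (A *v x) \<le> opnorm A * norm x"
  unfolding opnorm_def by (rule onorm) (rule matrix_vector_mul_bounded_linear)

lemma abs_entry_le_opnorm:
  fixes A :: "real ^ 'n ^ 'n"
  shows "\<bar>A $ i $ j\<bar> \<le> opnorm A"
proof -
  have "\<bar>A $ i $ j\<bar> = \<bar>(A *v axis j 1) $ i\<bar>"
    by (simp add: matrix_vector_mult_basis column_def)
  also have "\<dots> \<le> norm (A *v axis j 1)"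
    by (rule component_le_norm_cart)
  also have "\<dots> \<le> opnorm A"
    using norm_matrix_vector_le_opnorm[of A "axis j 1"] by simp
  finally show ?thesis .
qed

text \<open>The operator norm bounds every entry, so the Lipschitz condition passes to entries, the
  form in which the measurability of Cramer's rule needs it.\<close>

lemma matrix_lipschitz_continuous_entry:
  assumes "matrix_lipschitz L G"
  shows "continuous_on S (\<lambda>x. G x $ i $ j)"
proof -
  \<comment> \<open>\<open>max L 0\<close> because \<open>lipschitz_on\<close> demands a nonnegative
    constant.\<close>
  have "\<bar>G x $ i $ j - G y $ i $ j\<bar> \<le> max L 0 * norm (x - y)" for x y
  proof -
    have "\<bar>G x $ i $ j - G y $ i $ j\<bar> \<le> opnorm (G x - G y)"
      using abs_entry_le_opnorm[of "G x - G y" i j] by simp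
    also have "\<dots> \<le> L * norm (x - y)"
      using assms by (simp add: matrix_lipschitz_def)
    also have "\<dots> \<le> max L 0 * norm (x - y)"
      by (intro mult_right_mono) auto
    finally show ?thesis .
  qed
  then have "(max L 0)-lipschitz_on S (\<lambda>x. G x $ i $ j)"
    by (intro lipschitz_onI) (auto simp: dist_norm)
  then show ?thesis by (rule lipschitz_on_continuous_on)
qed

text \<open>Write \<open>x\<close> as \<open>matrix_inv A *v (A *v x)\<close>. Read as a lower
  bound, \<open>A\<close> scales norms by at least
  \<open>inverse (opnorm (matrix_inv A))\<close>.\<close>

lemma norm_le_opnorm_matrix_inv:
  fixes A :: "real ^ 'n ^ 'n"
  assumes "invertible A"
  shows "norm x \<le> opnorm (matrix_inv A) * norm (A *v x)"
proof -
  have "matrix_inv A ** A = mat 1"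
    using assms unfolding invertible_def matrix_inv_def by (metis (mono_tags, lifting) someI_ex)
  then show ?thesis
    using norm_matrix_vector_le_opnorm[of "matrix_inv A" "A *v x"]
    by (simp add: matrix_vector_mul_assoc)
qed

lemma opnorm_matrix_inv_pos:
  fixes A :: "real ^ 'n ^ 'n"
  assumes "invertible A"
  shows "opnorm (matrix_inv A) > 0"
proof -
  \<comment> \<open>Any unit vector would do; \<open>undefined\<close> picks an arbitrary
    index.\<close>
  have "1 \<le> opnorm (matrix_inv A) * norm (A *v axis undefined 1)"
    using norm_le_opnorm_matrix_inv[OF assms, of "axis undefined 1"] by simp
  then show ?thesis
    by (smt (verit) mult_nonneg_nonneg mult_nonpos_nonneg norm_ge_zero)
qed

text \<open>Determinants are polynomials in the entries, and total division is measurable, which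
  also covers the points where \<open>A t\<close> is singular.\<close>

lemma borel_measurable_cramer_solution:
  fixes A :: "'a \<Rightarrow> real ^ 'n ^ 'n" and b :: "'a \<Rightarrow> real ^ 'n"
  assumes A: "\<And>i j. (\<lambda>t. A t $ i $ j) \<in> borel_measurable M"
    and b: "b \<in> borel_measurable M"
  shows "(\<lambda>t. \<chi> k. det (\<chi> i j. if j = k then b t $ i else A t $ i $ j) / det (A t))
    \<in> borel_measurable M"
proof -
  have b': "(\<lambda>t. b t $ i) \<in> borel_measurable M" for i
    using borel_measurable_inner[OF b borel_measurable_const[of "axis i 1"]] by (simp add: inner_axis)
  have det: "(\<lambda>t. det (B t)) \<in> borel_measurable M"
    if "\<And>i j. (\<lambda>t. B t $ i $ j) \<in> borel_measurable M" for B :: "'a \<Rightarrow> real ^ 'n ^ 'n"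
    unfolding det_def using that by (intro borel_measurable_sum borel_measurable_times borel_measurable_prod) auto
  have "(\<lambda>t. det (\<chi> i j. if j = k then b t $ i else A t $ i $ j) / det (A t)) \<in> borel_measurable M" for k
    using A b' by (intro borel_measurable_divide det) auto
  then show ?thesis
    by (subst borel_measurable_euclidean_space) (auto simp: Basis_vec_def inner_axis)
qed

text \<open>Discards the right endpoint, where \<open>borel_measurable_derivative_version\<close>
  gives no information.\<close>

lemma AE_ne_right_endpoint: "AE t in lebesgue_on {a..b::real}. t \<in> {a..<b}"
  unfolding AE_lebesgue_on_Icc_iff by (intro exI[of _ "{b}"]) auto

text \<open>A singular \<open>A\<close> is allowed: division by zero then makes \<open>w\<close> vanish, and the bounds force
  \<open>b = 0\<close>. This occurs on the boundary of \<open>B_know\<close> when \<open>Lf = 0\<close>.\<close>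

lemma cramer_solution_norm_le_1:
  fixes A A0 :: "real ^ 'n ^ 'n"
  assumes inv: "invertible A0" and dist: "opnorm (A - A0) \<le> \<rho>"
    and b: "norm b \<le> inverse (opnorm (matrix_inv A0)) - \<rho>"
  defines "w \<equiv> \<chi> k. det (\<chi> i j. if j = k then b $ i else A $ i $ j) / det A"
  shows "A *v w = b \<and> norm w \<le> 1"
proof -
  define a where "a = inverse (opnorm (matrix_inv A0))"
  have pos: "opnorm (matrix_inv A0) > 0"
    using opnorm_matrix_inv_pos[OF inv] .
  \<comment> \<open>\<open>A0\<close> scales norms by at least \<open>a\<close>, and the
    perturbation takes away at most \<open>\<rho>\<close>.\<close>
  have lower: "(a - \<rho>) * norm x \<le> norm (A *v x)" for x
  proof -
    have "a * norm x \<le> norm (A0 *v x)"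
      using norm_le_opnorm_matrix_inv[OF inv, of x] pos
      by (simp add: a_def field_simps)
    also have "A0 *v x = A *v x - (A - A0) *v x"
      by (simp add: matrix_vector_mult_diff_rdistrib)
    also have "norm \<dots> \<le> norm (A *v x) + norm ((A - A0) *v x)"
      by (rule norm_triangle_ineq4)
    also have "norm ((A - A0) *v x) \<le> \<rho> * norm x"
      using norm_matrix_vector_le_opnorm[of "A - A0" x] mult_right_mono[OF dist, of "norm x"] by simp
    finally show ?thesis by (simp add: algebra_simps)
  qed
  have nonneg: "a - \<rho> \<ge> 0"
    using b norm_ge_zero[of b] unfolding a_def by linarith
  show ?thesis
  proof (cases "det A = 0")
    case True
    then have w: "w = 0" by (simp add: w_def vec_eq_iff)
    obtain x where x: "x \<noteq> 0" "A *v x = 0"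
      using True by (metis invertible_det_nz invertible_left_inverse matrix_left_invertible_ker)
    then have "a - \<rho> \<le> 0"
      using lower[of x] by (simp add: mult_le_0_iff)
    then have "norm b \<le> 0" using b unfolding a_def by linarith
    then have "b = 0" by simp
    then show ?thesis using w by simp
  next
    case False
    then have Aw: "A *v w = b"
      unfolding w_def by (simp add: cramer)
    moreover have "norm w \<le> 1"
    \<comment> \<open>The factor \<open>a - \<rho>\<close> cannot be cancelled when it is zero; in
      that case \<open>b = 0\<close>, and injectivity of \<open>A\<close> gives
      \<open>w = 0\<close>.\<close>
    proof (cases "a - \<rho> = 0")
      case True
      then have "A *v w = 0" using b Aw by (simp add: a_def)
      then have "w = 0"
        using False by (metis invertible_det_nz invertible_left_inverse matrix_left_invertible_ker)
      then show ?thesis by simp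
    next
      case ne: False
      have "(a - \<rho>) * norm w \<le> (a - \<rho>) * 1"
        using lower[of w] Aw b by (simp add: a_def)
      then show ?thesis using ne nonneg by (simp add: mult_le_cancel_left)
    qed
    ultimately show ?thesis by simp
  qed
qed

section \<open>Velocity sets and reachable sets\<close>

text \<open>Beyond the radius of \<open>B_know\<close> the value of \<open>g_fun\<close> is zero and
  the ball degenerates to the single velocity \<open>f 0\<close>, so one formula covers both
  cases.\<close>

lemma V_bar_eq_cball_g_fun:
  assumes "Lf + LG > 0" "invertible (G 0)"
  shows "V_bar Lf LG f G x = cball (f 0) (g_fun Lf LG G (norm x))"
proof -
  have "1 / ((Lf + LG) * opnorm (matrix_inv (G 0))) = inverse (opnorm (matrix_inv (G 0))) / (LG + Lf)"
    by (simp add: field_simps)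
  then show ?thesis
    by (simp add: V_bar_def B_know_def g_fun_def algebra_simps)
qed

text \<open>A solution of the inclusion is driven by the deviation of its velocity from
  \<open>f 0\<close>, divided by \<open>g_fun\<close>; conversely, \<open>g_fun\<close> times a
  control in the unit ball stays within the radius of the velocity set.\<close>

lemma inclusion_reach_eq_control_reach:
  assumes "Lf + LG > 0" "invertible (G 0)"
  shows "inclusion_reach (V_bar Lf LG f G) T 0
      = control_reach (\<lambda>x v. f 0 + g_fun Lf LG G (norm x) *\<^sub>R v) T 0"
proof (intro equalityI subsetI)
  let ?g = "\<lambda>x. g_fun Lf LG G (norm x)"
  have g_nonneg: "?g x \<ge> 0" for x
    using assms(1) by (simp add: g_fun_def pos_le_divide_eq mult.commute add.commute)
  fix y
  { assume "y \<in> inclusion_reach (V_bar Lf LG f G) T 0"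
    then obtain \<phi> where y: "y = \<phi> T" and ac: "absolutely_continuous_on_Icc 0 T \<phi>" and "\<phi> 0 = 0"
      and ae: "AE t in lebesgue_on {0..T}. \<exists>v\<in>cball (f 0) (?g (\<phi> t)).
        (\<phi> has_vector_derivative v) (at t within {0..T})"
      unfolding inclusion_reach_def inclusion_trajectory_def
      by (auto simp: V_bar_eq_cball_g_fun[where G = G, OF assms])
    have cont: "continuous_on {0..T} \<phi>"
      using ac by (rule absolutely_continuous_on_Icc_imp_continuous_on)
    then have [measurable]: "\<phi> \<in> borel_measurable (lebesgue_on {0..T})"
      by (intro continuous_imp_measurable_on_sets_lebesgue) auto
    obtain v where v[measurable]: "v \<in> borel_measurable (lebesgue_on {0..T})"
      and v_deriv: "\<And>t d. t \<in> {0..<T} \<Longrightarrow> (\<phi> has_vector_derivative d) (at t within {0..T}) \<Longrightarrow> v t = d"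
      using borel_measurable_derivative_version[OF cont] by blast
    \<comment> \<open>Where \<open>?g (\<phi> t)\<close> is zero, so is its inverse and the control
      vanishes; the inclusion then forces \<open>v t = f 0\<close>.\<close>
    have "(\<lambda>t. inverse (?g (\<phi> t)) *\<^sub>R (v t - f 0)) \<in> borel_measurable (lebesgue_on {0..T})"
      unfolding g_fun_def by measurable
    moreover have "AE t in lebesgue_on {0..T}. norm (inverse (?g (\<phi> t)) *\<^sub>R (v t - f 0)) \<le> 1 \<and>
      (\<phi> has_vector_derivative f 0 + ?g (\<phi> t) *\<^sub>R (inverse (?g (\<phi> t)) *\<^sub>R (v t - f 0)))
        (at t within {0..T})"
      using ae AE_ne_right_endpoint
    proof eventually_elim
      case (elim t)
      then have *: "norm (v t - f 0) \<le> ?g (\<phi> t)" "(\<phi> has_vector_derivative v t) (at t within {0..T})"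
        using v_deriv by (auto simp: dist_norm norm_minus_commute)
      then show ?case
        using g_nonneg[of "\<phi> t"] by (cases "?g (\<phi> t) = 0") (auto simp: pos_divide_le_eq divide_inverse[symmetric] inverse_eq_divide simp flip: scaleR_right_diff_distrib)
    qed
    ultimately show "y \<in> control_reach (\<lambda>x v. f 0 + ?g x *\<^sub>R v) T 0"
      unfolding y using ac \<open>\<phi> 0 = 0\<close> by (intro control_reachI)
  next
    assume "y \<in> control_reach (\<lambda>x v. f 0 + ?g x *\<^sub>R v) T 0"
    then obtain \<phi> u where y: "y = \<phi> T" and "control_signal T u"
      and "control_trajectory (\<lambda>x v. f 0 + ?g x *\<^sub>R v) T 0 u \<phi>"
      unfolding control_reach_def by blast
    moreover from this have "AE t in lebesgue_on {0..T}. \<exists>v\<in>cball (f 0) (?g (\<phi> t)).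
        (\<phi> has_vector_derivative v) (at t within {0..T})"
    proof -
      have u: "norm (u t) \<le> 1" if "t \<in> {0..T}" for t
        using \<open>control_signal T u\<close> that by (simp add: control_signal_def)
      have mem: "f 0 + ?g (\<phi> t) *\<^sub>R u t \<in> cball (f 0) (?g (\<phi> t))" if "t \<in> {0..<T}" for t
        using u[of t] that g_nonneg[of "\<phi> t"] mult_left_mono[of "norm (u t)" 1 "?g (\<phi> t)"]
        by (simp add: dist_norm)
      have "AE t in lebesgue_on {0..T}.
          (\<phi> has_vector_derivative f 0 + ?g (\<phi> t) *\<^sub>R u t) (at t within {0..T})"
        using \<open>control_trajectory _ T 0 u \<phi>\<close> by (simp add: control_trajectory_def)
      then show ?thesis
        using AE_ne_right_endpoint by eventually_elim (use mem in blast)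
    qed
    ultimately show "y \<in> inclusion_reach (V_bar Lf LG f G) T 0"
      unfolding inclusion_reach_def inclusion_trajectory_def control_trajectory_def
      by (auto simp: V_bar_eq_cball_g_fun[where G = G, OF assms])
  }
qed

text \<open>An instance of \<open>stays_in_convex_if_straight_outside\<close> with the ball
  \<open>B_know\<close> as \<open>C\<close> and with \<open>f 0\<close>, the only velocity permitted
  outside it.\<close>

lemma inclusion_trajectory_stays_in_B_know:
  assumes \<phi>: "inclusion_trajectory (V_bar Lf LG f G) T 0 \<phi>"
    and "Lf + LG > 0" "invertible (G 0)" and "\<phi> T \<in> B_know Lf LG G" and t: "t \<in> {0..T}"
  shows "\<phi> t \<in> B_know Lf LG G"
proof -
  have ac: "absolutely_continuous_on_Icc 0 T \<phi>"
    using \<phi> by (simp add: inclusion_trajectory_def)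
  obtain N where N: "negligible N" and deriv: "\<And>t. t \<in> {0..T} - N \<Longrightarrow>
      \<exists>v\<in>V_bar Lf LG f G (\<phi> t). (\<phi> has_vector_derivative v) (at t within {0..T})"
    using \<phi> unfolding inclusion_trajectory_def AE_lebesgue_on_Icc_iff by blast
  have "\<phi> 0 \<in> B_know Lf LG G"
    using \<phi> assms(2) opnorm_matrix_inv_pos[where A = "G 0", OF assms(3)]
    by (simp add: inclusion_trajectory_def B_know_def)
  then show ?thesis
    using stays_in_convex_if_straight_outside[OF ac _ _ _ assms(4) N _ t, of "f 0"] deriv
    by (fastforce simp: V_bar_def B_know_def)
qed

theorem mainTheorem3:
  fixes f :: "real ^ 'n \<Rightarrow> real ^ 'n" and G :: "real ^ 'n \<Rightarrow> real ^ 'n ^ 'n"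
    and Lf LG T :: real
  assumes "Lf \<ge> 0" and "LG \<ge> 0" and "Lf + LG > 0"
    and "Lf-lipschitz_on UNIV f"
    and "matrix_lipschitz LG G"
    and "invertible (G 0)"
    and "T \<ge> 0"
  shows "inclusion_reach (V_bar Lf LG f G) T 0
      = control_reach (\<lambda>x v. f 0 + g_fun Lf LG G (norm x) *\<^sub>R v) T 0
    \<and> inclusion_reach (V_bar Lf LG f G) T 0 \<inter> B_know Lf LG G \<subseteq> guaranteed_reach Lf LG f G T"
proof (intro conjI subsetI)
  show "inclusion_reach (V_bar Lf LG f G) T 0
      = control_reach (\<lambda>x v. f 0 + g_fun Lf LG G (norm x) *\<^sub>R v) T 0"
    using assms(3,6) by (rule inclusion_reach_eq_control_reach)
  fix y assume "y \<in> inclusion_reach (V_bar Lf LG f G) T 0 \<inter> B_know Lf LG G"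
  then obtain \<phi> where y: "y = \<phi> T" and \<phi>: "inclusion_trajectory (V_bar Lf LG f G) T 0 \<phi>"
      and last: "\<phi> T \<in> B_know Lf LG G"
    unfolding inclusion_reach_def by blast
  then have ac: "absolutely_continuous_on_Icc 0 T \<phi>" and start: "\<phi> 0 = 0"
    and ae: "AE t in lebesgue_on {0..T}. \<exists>v\<in>V_bar Lf LG f G (\<phi> t).
        (\<phi> has_vector_derivative v) (at t within {0..T})"
    by (auto simp: inclusion_trajectory_def)
  have stays: "\<phi> t \<in> B_know Lf LG G" if "t \<in> {0..T}" for t
    using inclusion_trajectory_stays_in_B_know[OF \<phi> assms(3,6) last that] .
  have cont: "continuous_on {0..T} \<phi>"
    using ac by (rule absolutely_continuous_on_Icc_imp_continuous_on)
  \<comment> \<open>\<open>v\<close> depends on the curve alone, so one version serves all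
    admissible systems.\<close>
  obtain v where v[measurable]: "v \<in> borel_measurable (lebesgue_on {0..T})"
    and v_deriv: "\<And>t d. t \<in> {0..<T} \<Longrightarrow> (\<phi> has_vector_derivative d) (at t within {0..T}) \<Longrightarrow> v t = d"
    using borel_measurable_derivative_version[OF cont] by blast
  have "\<phi> T \<in> control_reach (\<lambda>x u. fh x + Gh x *v u) T 0"
    if D: "(fh, Gh) \<in> D_con Lf LG f G" for fh Gh
  proof -
    have fh: "fh 0 = f 0" "Lf-lipschitz_on UNIV fh" and Gh: "Gh 0 = G 0" "matrix_lipschitz LG Gh"
      using D by (auto simp: D_con_def)
    have entry: "(\<lambda>t. Gh (\<phi> t) $ i $ j) \<in> borel_measurable (lebesgue_on {0..T})" for i j
      by (intro continuous_imp_measurable_on_sets_lebesgue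
            continuous_on_compose2[OF matrix_lipschitz_continuous_entry[OF Gh(2), of UNIV] cont]) auto
    have [measurable]: "(\<lambda>t. fh (\<phi> t)) \<in> borel_measurable (lebesgue_on {0..T})"
      by (intro continuous_imp_measurable_on_sets_lebesgue
            continuous_on_compose2[OF lipschitz_on_continuous_on[OF fh(2)] cont]) auto
    define b where "b t = v t - fh (\<phi> t)" for t
    have "b \<in> borel_measurable (lebesgue_on {0..T})"
      unfolding b_def by measurable
    note meas = borel_measurable_cramer_solution[of "\<lambda>t. Gh (\<phi> t)", OF entry this]
    show ?thesis
    proof (rule control_reachI[OF ac start meas])
      show "AE t in lebesgue_on {0..T}.
        norm (\<chi> k. det (\<chi> i j. if j = k then b t $ i else Gh (\<phi> t) $ i $ j) / det (Gh (\<phi> t))) \<le> 1 \<and>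
        (\<phi> has_vector_derivative fh (\<phi> t) + Gh (\<phi> t) *v
          (\<chi> k. det (\<chi> i j. if j = k then b t $ i else Gh (\<phi> t) $ i $ j) / det (Gh (\<phi> t))))
         (at t within {0..T})"
        using ae AE_ne_right_endpoint
      proof eventually_elim
        case (elim t)
        then have v_t: "v t \<in> V_bar Lf LG f G (\<phi> t)" "(\<phi> has_vector_derivative v t) (at t within {0..T})"
          using v_deriv by auto
        define a where "a = inverse (opnorm (matrix_inv (G 0)))"
        \<comment> \<open>\<open>stays\<close> selects the ball branch of
          \<open>V_bar\<close>.\<close>
        have "norm (v t - f 0) \<le> a - Lf * norm (\<phi> t) - LG * norm (\<phi> t)"
          using v_t(1) stays[of t] elim by (simp add: V_bar_def a_def dist_norm norm_minus_commute)
        moreover have "norm (f 0 - fh (\<phi> t)) \<le> Lf * norm (\<phi> t)"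
          using lipschitz_onD[OF fh(2), of 0 "\<phi> t"] fh(1) by (simp add: dist_norm)
        moreover have "norm (b t) \<le> norm (v t - f 0) + norm (f 0 - fh (\<phi> t))"
          using norm_triangle_ineq[of "v t - f 0" "f 0 - fh (\<phi> t)"] by (simp add: b_def)
        \<comment> \<open>The drift deviation uses up the \<open>Lf\<close> term of the radius; what
          remains is the bound that \<open>cramer_solution_norm_le_1\<close> asks for with
          \<open>\<rho> = LG * norm (\<phi> t)\<close>.\<close>
        ultimately have "norm (b t) \<le> inverse (opnorm (matrix_inv (Gh 0))) - LG * norm (\<phi> t)"
          by (simp add: a_def Gh(1))
        moreover have "opnorm (Gh (\<phi> t) - Gh 0) \<le> LG * norm (\<phi> t)"
          using Gh(2) unfolding matrix_lipschitz_def by (metis diff_zero)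
        moreover have "invertible (Gh 0)" using assms(6) Gh(1) by simp
        ultimately show ?case
          using cramer_solution_norm_le_1[of "Gh 0" "Gh (\<phi> t)" "LG * norm (\<phi> t)" "b t"] v_t(2)
          by (simp add: b_def)
      qed
    qed
  qed
  then show "y \<in> guaranteed_reach Lf LG f G T"
    unfolding guaranteed_reach_def y by auto
qed

end
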